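(* Let $G$ be a group (not necessarily abelian), written multiplicatively with identity element $1$. Let $A$ be a nonempty finite subset of $G$. Then there is a matching from $A$ to $A$ if and only if $1 \notin A$.
   Context: Given nonempty finite subsets $A, B$ of a group $G$ (written multiplicatively), a matching from $A$ to $B$ is a bijective map $\varphi : A \rightarrow B$ such that $a\varphi(a) \notin A$ for all $a \in A$. A matching from $A$ to $A$ is the case $B = A$. *)

theory Defs
  imports "HOL-Algebra.Group"
begin

definition is_matching ::
    "('a, 'b) monoid_scheme \<Rightarrow> 'a set \<Rightarrow> 'a set \<Rightarrow> ('a \<Rightarrow> 'a) \<Rightarrow> bool"
  where "is_matching G A B \<phi> \<longleftrightarrow>
    bij_betw \<phi> A B \<and> (\<forall>a\<in>A. a \<otimes>\<^bsub>G\<^esub> \<phi> a \<notin> A)"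

end

theory Submission
  imports Defs
begin

text \<open>
  If \<open>\<one> \<in> A\<close>, a matching sends some \<open>a \<in> A\<close> to \<open>\<one>\<close>, and then \<open>a \<otimes> \<phi> a = a\<close> lies in \<open>A\<close>.
  The substance is the converse.

  A matching from \<open>A\<close> to itself is a system of distinct representatives for the sets
  \<open>{b \<in> A. a \<otimes> b \<notin> A}\<close>, so Hall's marriage theorem (\<open>hall_marriage\<close>) applies. For \<open>S \<subseteq> A\<close>, the
  elements of \<open>A\<close> that no member of \<open>S\<close> admits form \<open>T = {b \<in> A. \<forall>s\<in>S. s \<otimes> b \<in> A}\<close>, so Hall's
  condition for \<open>S\<close> is the inequality \<open>|S| + |T| \<le> |A|\<close>. Adjoin \<open>\<one>\<close> to all three sets: the product
  set of \<open>S \<union> {\<one>}\<close> and \<open>T \<union> {\<one>}\<close> lies in \<open>A \<union> {\<one>}\<close>. Because \<open>\<one> \<notin> A\<close>, none of \<open>S\<close>, \<open>T\<close>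
  and the set of products \<open>s \<otimes> t\<close> contains \<open>\<one>\<close>, so \<open>\<one> = \<one> \<otimes> \<one>\<close> is the only way to write \<open>\<one>\<close>
  as a product from these two sets. The inequality is then a theorem of Scherk and
  Kemperman: \<open>|X| + |Y| - 1 \<le> |XY|\<close> as soon as some product, here \<open>\<one>\<close>, is represented only
  once (\<open>card_product_unique_one\<close>).

  That theorem is immediate when \<open>X \<inter> Y = {\<one>}\<close>, since \<open>XY\<close> contains \<open>X \<union> Y\<close>. Otherwise a
  nontrivial \<open>x \<in> X \<inter> Y\<close> allows \<open>(X, Y)\<close> to be replaced by \<open>(X \<union> Xx, Y \<inter> x\<^sup>-\<^sup>1Y)\<close> or by
  \<open>(X \<inter> Xx\<^sup>-\<^sup>1, Y \<union> xY)\<close>. Neither enlarges the product set, both keep the representation of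
  \<open>\<one>\<close> unique, and on average they preserve \<open>|X| + |Y|\<close>.
\<close>

section \<open>Hall's marriage theorem\<close>

text \<open>
  Rado's argument: as long as some \<open>N a\<close> has two elements \<open>x \<noteq> y\<close>, one of them can be deleted
  without violating Hall's condition. Otherwise there are violating sets \<open>T1 \<union> {a}\<close> and
  \<open>T2 \<union> {a}\<close> for the two deletions. The neighbourhoods of these violating sets together cover
  that of \<open>T1 \<union> T2 \<union> {a}\<close>, because \<open>x\<close> and \<open>y\<close> are not both missing, and their intersection
  contains that of \<open>T1 \<inter> T2\<close>; counting contradicts Hall's condition. Once all sets are
  singletons, the condition on two-element subsets is injectivity.
\<close>

lemma hall_marriage:
  fixes N :: "'i \<Rightarrow> 'b set"
  assumes "finite I" and "\<And>i. i \<in> I \<Longrightarrow> finite (N i)"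
    and "\<And>S. S \<subseteq> I \<Longrightarrow> card S \<le> card (\<Union>i\<in>S. N i)"
  shows "\<exists>f. inj_on f I \<and> (\<forall>i\<in>I. f i \<in> N i)"
  using assms
proof (induction "\<Sum>i\<in>I. card (N i)" arbitrary: N rule: less_induct)
  case less
  note finI = less.prems(1) and finN = less.prems(2) and hall = less.prems(3)
  have ne: "N i \<noteq> {}" if "i \<in> I" for i
    using hall[of "{i}"] that by auto
  show ?case
  proof (cases "\<exists>a\<in>I. \<exists>x\<in>N a. \<exists>y\<in>N a. x \<noteq> y")
    case False
    define f where "f i = (SOME x. x \<in> N i)" for i
    have fN: "N i = {f i}" if "i \<in> I" for i
    proof -
      have "f i \<in> N i"
        unfolding f_def using ne[OF that] some_in_eq by blast
      then show ?thesis using False that by blast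
    qed
    have "inj_on f I"
    proof (rule inj_onI, rule ccontr)
      fix i j assume ij: "i \<in> I" "j \<in> I" "f i = f j" "i \<noteq> j"
      have "card {i, j} \<le> card (\<Union>k\<in>{i, j}. N k)"
        using ij by (intro hall) auto
      also have "(\<Union>k\<in>{i, j}. N k) = {f i}"
        using fN[OF ij(1)] fN[OF ij(2)] ij(3) by auto
      finally show False using ij(4) by simp
    qed
    then show ?thesis using fN by blast
  next
    case True
    then obtain a x y where a: "a \<in> I" and x: "x \<in> N a" and y: "y \<in> N a" and xy: "x \<noteq> y"
      by blast
    have violator: "\<exists>T. T \<subseteq> I - {a} \<and> card ((\<Union>i\<in>T. N i) \<union> (N a - {z})) \<le> card T"
      if z: "z \<in> N a" and no: "\<nexists>f. inj_on f I \<and> (\<forall>i\<in>I. f i \<in> N i)" for z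
    proof -
      define M where "M = N(a := N a - {z})"
      have sub: "M i \<subseteq> N i" for i by (auto simp: M_def)
      have finM: "finite (M i)" if "i \<in> I" for i
        using finN[OF that] sub finite_subset by blast
      have smaller: "(\<Sum>i\<in>I. card (M i)) < (\<Sum>i\<in>I. card (N i))"
      proof (rule sum_strict_mono_ex1[OF finI])
        show "\<forall>i\<in>I. card (M i) \<le> card (N i)"
          using sub finN by (auto intro: card_mono)
        have "card (M a) < card (N a)"
          unfolding M_def using card_Diff1_less[OF finN[OF a] z] by simp
        then show "\<exists>i\<in>I. card (M i) < card (N i)" using a by blast
      qed
      have "\<exists>S. S \<subseteq> I \<and> \<not> card S \<le> card (\<Union>i\<in>S. M i)"
      proof (rule ccontr)
        assume "\<nexists>S. S \<subseteq> I \<and> \<not> card S \<le> card (\<Union>i\<in>S. M i)"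
        then have "\<exists>f. inj_on f I \<and> (\<forall>i\<in>I. f i \<in> M i)"
          by (intro less.hyps[OF smaller finI finM]) auto
        then show False using no sub by blast
      qed
      then obtain S where S: "S \<subseteq> I" "\<not> card S \<le> card (\<Union>i\<in>S. M i)" by blast
      have aS: "a \<in> S"
      proof (rule ccontr)
        assume "a \<notin> S"
        then have "(\<Union>i\<in>S. M i) = (\<Union>i\<in>S. N i)" by (auto simp: M_def)
        then show False using hall[OF S(1)] S(2) by simp
      qed
      have "(\<Union>i\<in>S. M i) = (\<Union>i\<in>S - {a}. N i) \<union> (N a - {z})"
        using aS by (auto simp: M_def split: if_splits)
      moreover have "card S = Suc (card (S - {a}))"
        using card.remove[OF finite_subset[OF S(1) finI] aS] by simp
      ultimately have "card ((\<Union>i\<in>S - {a}. N i) \<union> (N a - {z})) \<le> card (S - {a})"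
        using S(2) by (metis not_less_eq_eq)
      then show ?thesis using S(1) by blast
    qed
    show ?thesis
    proof (rule ccontr)
      assume no: "\<not> ?thesis"
      define U where "U T = (\<Union>i\<in>T. N i)" for T
      obtain T1 where T1: "T1 \<subseteq> I - {a}" "card (U T1 \<union> (N a - {x})) \<le> card T1"
        using violator[OF x no] unfolding U_def by blast
      obtain T2 where T2: "T2 \<subseteq> I - {a}" "card (U T2 \<union> (N a - {y})) \<le> card T2"
        using violator[OF y no] unfolding U_def by blast
      define P1 where "P1 = U T1 \<union> (N a - {x})"
      define P2 where "P2 = U T2 \<union> (N a - {y})"
      have finT: "finite T1" "finite T2"
        using T1(1) T2(1) finI by (auto intro: finite_subset)
      have finP: "finite P1" "finite P2"
        using finT T1(1) T2(1) finN a by (auto simp: P1_def P2_def U_def)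
      have "card (insert a (T1 \<union> T2)) \<le> card (U (insert a (T1 \<union> T2)))"
        unfolding U_def using T1(1) T2(1) a by (intro hall) auto
      also have "U (insert a (T1 \<union> T2)) = P1 \<union> P2"
        unfolding P1_def P2_def U_def using x y xy by auto
      finally have un: "Suc (card (T1 \<union> T2)) \<le> card (P1 \<union> P2)"
        using T1(1) T2(1) finT by (subst (asm) card_insert_disjoint) auto
      have "card (T1 \<inter> T2) \<le> card (U (T1 \<inter> T2))"
        unfolding U_def using T1(1) by (intro hall) auto
      also have "\<dots> \<le> card (P1 \<inter> P2)"
        using finP by (intro card_mono) (auto simp: P1_def P2_def U_def)
      finally show False
        using un card_Un_Int[OF finT] card_Un_Int[OF finP]
          T1(2)[folded P1_def] T2(2)[folded P2_def] by linarith
    qed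
  qed
qed

section \<open>Product sets in which the identity is uniquely represented\<close>

context group
begin

text \<open>
  A transform step enlarges one factor at the expense of the other without creating products:
  \<open>(a \<otimes> x) \<otimes> b = a \<otimes> (x \<otimes> b)\<close> is an old product, because \<open>x \<otimes> b\<close> is required to lie in \<open>Y\<close>.
  A new representation of \<open>\<one>\<close> could only arise from the old \<open>\<one> \<otimes> \<one>\<close> as \<open>x \<otimes> x\<^sup>-\<^sup>1\<close>, but
  \<open>x\<^sup>-\<^sup>1 \<notin> Y\<close>, since \<open>x \<in> X\<close> and \<open>x \<otimes> x\<^sup>-\<^sup>1\<close> would have been a second representation from the start.
\<close>

lemma right_transform_unique_one:
  assumes X: "X \<subseteq> carrier G" and Y: "Y \<subseteq> carrier G"
    and unique: "\<And>a b. a \<in> X \<Longrightarrow> b \<in> Y \<Longrightarrow> a \<otimes> b = \<one> \<Longrightarrow> a = \<one>"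
    and x: "x \<in> X" "x \<noteq> \<one>"
    and a: "a \<in> X \<union> (\<lambda>a. a \<otimes> x) ` X" and b: "b \<in> Y" "x \<otimes> b \<in> Y"
    and ab: "a \<otimes> b = \<one>"
  shows "a = \<one>"
proof (cases "a \<in> X")
  case True
  then show ?thesis using unique b(1) ab by blast
next
  case False
  then obtain c where c: "c \<in> X" "a = c \<otimes> x" using a by auto
  have xG: "x \<in> carrier G" and bG: "b \<in> carrier G" and cG: "c \<in> carrier G"
    using x b c X Y by auto
  have "c \<otimes> (x \<otimes> b) = \<one>" using ab c(2) cG xG bG by (simp add: m_assoc)
  then have "c = \<one>" using unique c(1) b(2) by blast
  then have "x \<otimes> b = \<one>" using ab c(2) xG by simp
  then show ?thesis using unique x b(1) by blast
qed

lemma left_transform_unique_one: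
  assumes X: "X \<subseteq> carrier G" and Y: "Y \<subseteq> carrier G"
    and unique: "\<And>a b. a \<in> X \<Longrightarrow> b \<in> Y \<Longrightarrow> a \<otimes> b = \<one> \<Longrightarrow> a = \<one>"
    and x: "x \<in> Y" "x \<noteq> \<one>"
    and a: "a \<in> X" "a \<otimes> x \<in> X" and b: "b \<in> Y \<union> (\<lambda>b. x \<otimes> b) ` Y"
    and ab: "a \<otimes> b = \<one>"
  shows "a = \<one>"
proof (cases "b \<in> Y")
  case True
  then show ?thesis using unique a(1) ab by blast
next
  case False
  then obtain c where c: "c \<in> Y" "b = x \<otimes> c" using b by auto
  have xG: "x \<in> carrier G" and aG: "a \<in> carrier G" and cG: "c \<in> carrier G"
    using x a c X Y by auto
  have "(a \<otimes> x) \<otimes> c = \<one>" using ab c(2) cG xG aG by (simp add: m_assoc)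
  moreover from this have "a \<otimes> x = \<one>" using unique a(2) c(1) by blast
  ultimately show ?thesis using unique a(1) x(1) by blast
qed

text \<open>
  Of \<open>X\<close>, \<open>X \<union> Xx\<close> and \<open>X \<inter> Xx\<^sup>-\<^sup>1\<close>, the middle one has as many elements more than \<open>X\<close> as the last
  has fewer, because the last is, up to translation, \<open>X \<inter> Xx\<close>.
\<close>

lemma card_right_transform:
  assumes "X \<subseteq> carrier G" "finite X" "x \<in> carrier G"
  shows "card (X \<union> (\<lambda>a. a \<otimes> x) ` X) + card {a \<in> X. a \<otimes> x \<in> X} = 2 * card X"
proof -
  have inj: "inj_on (\<lambda>a. a \<otimes> x) X"
    using assms by (intro inj_onI) (auto simp: subset_iff)
  have "X \<inter> (\<lambda>a. a \<otimes> x) ` X = (\<lambda>a. a \<otimes> x) ` {a \<in> X. a \<otimes> x \<in> X}" by auto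
  moreover have "card ((\<lambda>a. a \<otimes> x) ` {a \<in> X. a \<otimes> x \<in> X}) = card {a \<in> X. a \<otimes> x \<in> X}"
    by (rule card_image) (rule inj_on_subset[OF inj], auto)
  ultimately show ?thesis
    using card_Un_Int[of X "(\<lambda>a. a \<otimes> x) ` X"] card_image[OF inj] assms by simp
qed

lemma card_left_transform:
  assumes "Y \<subseteq> carrier G" "finite Y" "x \<in> carrier G"
  shows "card (Y \<union> (\<lambda>b. x \<otimes> b) ` Y) + card {b \<in> Y. x \<otimes> b \<in> Y} = 2 * card Y"
proof -
  have inj: "inj_on (\<lambda>b. x \<otimes> b) Y"
    using assms by (intro inj_onI) (auto simp: subset_iff)
  have "Y \<inter> (\<lambda>b. x \<otimes> b) ` Y = (\<lambda>b. x \<otimes> b) ` {b \<in> Y. x \<otimes> b \<in> Y}" by auto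
  moreover have "card ((\<lambda>b. x \<otimes> b) ` {b \<in> Y. x \<otimes> b \<in> Y}) = card {b \<in> Y. x \<otimes> b \<in> Y}"
    by (rule card_image) (rule inj_on_subset[OF inj], auto)
  ultimately show ?thesis
    using card_Un_Int[of Y "(\<lambda>b. x \<otimes> b) ` Y"] card_image[OF inj] assms by simp
qed

text \<open>
  Fixing a set \<open>C\<close> that contains all products, rather than the product set itself, lets the
  induction vary \<open>X\<close> and \<open>Y\<close> while the bound stays put. Among the pairs that satisfy the
  hypotheses, take one with \<open>|X| + |Y|\<close> maximal, and then \<open>|X|\<close> maximal. A nontrivial
  \<open>x \<in> X \<inter> Y\<close> contradicts the choice: the two transforms by \<open>x\<close> have average size
  \<open>|X| + |Y|\<close>, so either the one that enlarges \<open>Y\<close> increases the sum, or the one that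
  enlarges \<open>X\<close> does not decrease it. The latter makes \<open>X\<close> strictly larger, since \<open>X = Xx\<close>
  would put \<open>x\<^sup>-\<^sup>1\<close> into \<open>X\<close> and \<open>\<one> = x\<^sup>-\<^sup>1 \<otimes> x\<close> would be a second representation.
\<close>

lemma card_product_unique_one:
  assumes "X \<subseteq> carrier G" "Y \<subseteq> carrier G" "\<one> \<in> X" "\<one> \<in> Y" "finite C"
    and "\<And>a b. a \<in> X \<Longrightarrow> b \<in> Y \<Longrightarrow> a \<otimes> b \<in> C"
    and "\<And>a b. a \<in> X \<Longrightarrow> b \<in> Y \<Longrightarrow> a \<otimes> b = \<one> \<Longrightarrow> a = \<one>"
  shows "card X + card Y \<le> card C + 1"
  using assms
proof (induction "(X, Y)" arbitrary: X Y
    rule: wf_induct_rule[OF wf_measures[of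
      "[\<lambda>(X, Y). 2 * card C - (card X + card Y), \<lambda>(X, Y). card C - card X]"]])
  case 1
  note IH = 1(1) and XG = 1(2) and YG = 1(3) and one = 1(4,5) and finC = 1(6)
    and prods = 1(7) and unique = 1(8)
  have sub: "X \<subseteq> C" "Y \<subseteq> C"
    using prods[OF _ one(2)] prods[OF one(1)] XG YG by (metis r_one l_one subset_iff)+
  then have fin: "finite X" "finite Y" using finC finite_subset by blast+
  show ?case
  proof (cases "X \<inter> Y = {\<one>}")
    case True
    have "card X + card Y = card (X \<union> Y) + 1"
      using card_Un_Int[OF fin] True by simp
    also have "card (X \<union> Y) \<le> card C" using sub finC by (simp add: card_mono)
    finally show ?thesis by simp
  next
    case False
    then obtain x where x: "x \<in> X" "x \<in> Y" "x \<noteq> \<one>" using one by blast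
    have xG: "x \<in> carrier G" using x XG by blast
    define X1 where "X1 = X \<union> (\<lambda>a. a \<otimes> x) ` X"
    define Y1 where "Y1 = {b \<in> Y. x \<otimes> b \<in> Y}"
    define X2 where "X2 = {a \<in> X. a \<otimes> x \<in> X}"
    define Y2 where "Y2 = Y \<union> (\<lambda>b. x \<otimes> b) ` Y"
    have G: "X1 \<subseteq> carrier G" "Y1 \<subseteq> carrier G" "X2 \<subseteq> carrier G" "Y2 \<subseteq> carrier G"
      unfolding X1_def Y1_def X2_def Y2_def using XG YG xG by auto
    have ones: "\<one> \<in> X1" "\<one> \<in> Y1" "\<one> \<in> X2" "\<one> \<in> Y2"
      unfolding X1_def Y1_def X2_def Y2_def using one x xG by auto
    have assoc: "(a \<otimes> x) \<otimes> b = a \<otimes> (x \<otimes> b)" if "a \<in> X" "b \<in> Y" for a b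
      using that XG YG xG by (auto intro: m_assoc)
    have prods1: "a \<otimes> b \<in> C" if "a \<in> X1" "b \<in> Y1" for a b
      using that prods unfolding X1_def Y1_def by (auto simp: assoc)
    have prods2: "a \<otimes> b \<in> C" if "a \<in> X2" "b \<in> Y2" for a b
      using that prods unfolding X2_def Y2_def by (auto simp: assoc[symmetric])
    have unique1: "a = \<one>" if "a \<in> X1" "b \<in> Y1" "a \<otimes> b = \<one>" for a b
    proof (rule right_transform_unique_one[OF XG YG _ x(1,3)])
      show "c = \<one>" if "c \<in> X" "d \<in> Y" "c \<otimes> d = \<one>" for c d
        using unique that .
    qed (use that in \<open>auto simp: X1_def Y1_def\<close>)
    have unique2: "a = \<one>" if "a \<in> X2" "b \<in> Y2" "a \<otimes> b = \<one>" for a b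
    proof (rule left_transform_unique_one[OF XG YG _ x(2,3)])
      show "c = \<one>" if "c \<in> X" "d \<in> Y" "c \<otimes> d = \<one>" for c d
        using unique that .
    qed (use that in \<open>auto simp: X2_def Y2_def\<close>)
    have sub1: "X1 \<subseteq> C" and "Y1 \<subseteq> C"
      using prods1[OF _ ones(2)] prods1[OF ones(1)] G by (metis r_one l_one subset_iff)+
    have "X2 \<subseteq> C" "Y2 \<subseteq> C"
      using prods2[OF _ ones(4)] prods2[OF ones(3)] G by (metis r_one l_one subset_iff)+
    with sub1 \<open>Y1 \<subseteq> C\<close> have le: "card X1 \<le> card C" "card Y1 \<le> card C" "card X2 \<le> card C"
        "card Y2 \<le> card C"
      using finC by (auto intro: card_mono)
    have total: "card X1 + card X2 = 2 * card X" "card Y2 + card Y1 = 2 * card Y"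
      unfolding X1_def X2_def Y1_def Y2_def
      using card_right_transform[OF XG fin(1) xG] card_left_transform[OF YG fin(2) xG] by auto
    have "X2 \<noteq> X"
    proof
      \<comment> \<open>An injective self-map of a finite set is onto, so \<open>\<one>\<close> would be of the form \<open>a \<otimes> x\<close>.\<close>
      assume "X2 = X"
      then have "(\<lambda>a. a \<otimes> x) ` X \<subseteq> X" unfolding X2_def by auto
      moreover have "inj_on (\<lambda>a. a \<otimes> x) X"
        using XG xG by (intro inj_onI) (auto simp: subset_iff)
      ultimately have "(\<lambda>a. a \<otimes> x) ` X = X" using fin(1) endo_inj_surj by blast
      then obtain a where a: "a \<in> X" "a \<otimes> x = \<one>" using one(1) by (metis imageE)
      then have "a = \<one>" using unique x(2) by blast
      then show False using a(2) x(3) xG by simp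
    qed
    then have "card X2 < card X"
      using fin(1) by (intro psubset_card_mono) (auto simp: X2_def)
    then have larger: "card X < card X1" using total(1) by linarith
    show ?thesis
    proof (cases "card X1 + card Y1 \<ge> card X + card Y")
      case True
      have "card X1 + card Y1 \<le> card C + 1"
      proof (rule IH[OF _ G(1,2) ones(1,2) finC])
        show "a \<otimes> b \<in> C" if "a \<in> X1" "b \<in> Y1" for a b using prods1 that .
        show "a = \<one>" if "a \<in> X1" "b \<in> Y1" "a \<otimes> b = \<one>" for a b using unique1 that .
      qed (use True larger le in auto)
      then show ?thesis using True by linarith
    next
      case False
      have more: "card X + card Y < card X2 + card Y2" using False total by linarith
      have "card X2 + card Y2 \<le> card C + 1"
      proof (rule IH[OF _ G(3,4) ones(3,4) finC])
        show "a \<otimes> b \<in> C" if "a \<in> X2" "b \<in> Y2" for a b using prods2 that .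
        show "a = \<one>" if "a \<in> X2" "b \<in> Y2" "a \<otimes> b = \<one>" for a b using unique2 that .
      qed (use more le in auto)
      then show ?thesis using more by linarith
    qed
  qed
qed

section \<open>Matchings\<close>

text \<open>
  With \<open>\<one>\<close> adjoined to all three sets, \<open>S\<close> and \<open>T\<close> themselves appear among the products, and
  \<open>\<one>\<close> is uniquely represented because neither \<open>S\<close> nor any \<open>s \<otimes> t\<close> meets \<open>\<one>\<close>. The three
  adjoined elements account exactly for the \<open>+ 1\<close> in \<open>card_product_unique_one\<close>.
\<close>

lemma card_add_card_le_of_products:
  assumes A: "A \<subseteq> carrier G" "finite A" "\<one> \<notin> A" and "S \<subseteq> A" "T \<subseteq> A"
    and prods: "\<And>s t. s \<in> S \<Longrightarrow> t \<in> T \<Longrightarrow> s \<otimes> t \<in> A"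
  shows "card S + card T \<le> card A"
proof -
  have "card (insert \<one> S) + card (insert \<one> T) \<le> card (insert \<one> A) + 1"
  proof (rule card_product_unique_one)
    show "insert \<one> S \<subseteq> carrier G" "insert \<one> T \<subseteq> carrier G" using assms by auto
    show "a \<otimes> b \<in> insert \<one> A" if "a \<in> insert \<one> S" "b \<in> insert \<one> T" for a b
      using that assms by (auto simp: subset_iff)
    show "a = \<one>" if "a \<in> insert \<one> S" "b \<in> insert \<one> T" "a \<otimes> b = \<one>" for a b
    proof (rule ccontr)
      assume "a \<noteq> \<one>"
      then have "a \<in> S" using that(1) by blast
      moreover from this have "a \<otimes> b \<in> A"
        using that(2) prods assms(4) A(1) by (auto simp: subset_iff)
      ultimately show False using that(3) A(3) by simp
    qed
  qed (use A in auto)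
  moreover have "finite S" "finite T" "\<one> \<notin> S" "\<one> \<notin> T"
    using assms finite_subset by blast+
  ultimately show ?thesis using A by simp
qed

lemma exists_matching:
  assumes A: "A \<subseteq> carrier G" "finite A" "\<one> \<notin> A"
  shows "\<exists>\<phi>. is_matching G A A \<phi>"
proof -
  define N where "N a = {b \<in> A. a \<otimes> b \<notin> A}" for a
  have "\<exists>\<phi>. inj_on \<phi> A \<and> (\<forall>a\<in>A. \<phi> a \<in> N a)"
  proof (rule hall_marriage[OF A(2)])
    show "finite (N a)" for a using A(2) by (simp add: N_def)
    fix S assume S: "S \<subseteq> A"
    let ?U = "\<Union>a\<in>S. N a"
    have U: "?U \<subseteq> A" by (auto simp: N_def)
    have "card S + card (A - ?U) \<le> card A"
      using S by (intro card_add_card_le_of_products[OF A]) (auto simp: N_def)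
    then show "card S \<le> card ?U"
      using card_Diff_subset[OF finite_subset[OF U A(2)] U] card_mono[OF A(2) U] by linarith
  qed
  then obtain \<phi> where \<phi>: "inj_on \<phi> A" "\<forall>a\<in>A. \<phi> a \<in> N a" by blast
  then have "\<phi> ` A = A"
    using A(2) by (intro endo_inj_surj) (auto simp: N_def)
  then show ?thesis
    using \<phi> unfolding is_matching_def bij_betw_def N_def by blast
qed

end

theorem theorem3p2:
  fixes G :: "('a, 'b) monoid_scheme" and A :: "'a set"
  assumes "group G"
    and "A \<subseteq> carrier G"
    and "finite A"
    and "A \<noteq> {}"
  shows "(\<exists>\<phi>. is_matching G A A \<phi>) \<longleftrightarrow> \<one>\<^bsub>G\<^esub> \<notin> A"
proof
  interpret group G by fact
  assume "\<exists>\<phi>. is_matching G A A \<phi>"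
  then obtain \<phi> where \<phi>: "\<phi> ` A = A" "\<forall>a\<in>A. a \<otimes>\<^bsub>G\<^esub> \<phi> a \<notin> A"
    unfolding is_matching_def bij_betw_def by blast
  show "\<one>\<^bsub>G\<^esub> \<notin> A"
  proof
    assume "\<one>\<^bsub>G\<^esub> \<in> A"
    then obtain a where a: "a \<in> A" "\<phi> a = \<one>\<^bsub>G\<^esub>" using \<phi>(1) by (metis imageE)
    then have "a \<otimes>\<^bsub>G\<^esub> \<phi> a = a" using assms(2) by auto
    then show False using \<phi>(2) a(1) by metis
  qed
next
  assume "\<one>\<^bsub>G\<^esub> \<notin> A"
  then show "\<exists>\<phi>. is_matching G A A \<phi>"
    by (rule group.exists_matching[OF assms(1-3)])
qed

end
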